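(* Let $n\in\mathbb{N}$, $0\le t_0<t<\infty$ and $\boldsymbol{y},\boldsymbol{z}\in\mathbb{R}^n$. For $d_1,\dots,d_n>0$ let $\boldsymbol{D}=\mathrm{diag}(d_1,\dots,d_n)$ and $$\kappa_{++}(t_0,\boldsymbol{y},t,\boldsymbol{z})=\frac{(\det \boldsymbol{M}_{tt_0})^{1/4}}{(2\pi)^{n/2}\sqrt{\det\left(\sinh(2(t-t_0)\sqrt{\boldsymbol{D}})\right)}}\exp\left(-\frac12\begin{pmatrix}\boldsymbol{y}^{\top}&\boldsymbol{z}^{\top}\end{pmatrix}\boldsymbol{M}_{tt_0}\begin{pmatrix}\boldsymbol{y}\\ \boldsymbol{z}\end{pmatrix}\right),$$ $$\boldsymbol{M}_{tt_0}=\begin{bmatrix}\sqrt{\boldsymbol{D}}\coth\left(2(t-t_0)\sqrt{\boldsymbol{D}}\right)&-\sqrt{\boldsymbol{D}}\,\mathrm{csch}\left(2(t-t_0)\sqrt{\boldsymbol{D}}\right)\\-\sqrt{\boldsymbol{D}}\,\mathrm{csch}\left(2(t-t_0)\sqrt{\boldsymbol{D}}\right)&\sqrt{\boldsymbol{D}}\coth\left(2(t-t_0)\sqrt{\boldsymbol{D}}\right)\end{bmatrix}.$$ Then $$\lim_{(d_1,\dots,d_n)\downarrow\boldsymbol{0}}\kappa_{++}(t_0,\boldsymbol{y},t,\boldsymbol{z})=\kappa_0(t_0,\boldsymbol{y},t,\boldsymbol{z}):=(4\pi(t-t_0))^{-n/2}\exp\left(-\frac{|\boldsymbol{y}-\b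oldsymbol{z}|^2}{4(t-t_0)}\right).$$
   Context: A scalar function applied to a diagonal matrix means the diagonal matrix obtained by applying the function to each diagonal entry; $\mathrm{csch}=1/\sinh$, $\coth=\cosh/\sinh$. The limit $(d_1,\dots,d_n)\downarrow\boldsymbol{0}$ is understood as $d_i\downarrow 0$ (through positive values) for all $i=1,\dots,n$. *)

theory Defs
  imports "HOL-Analysis.Analysis"
begin

definition coth :: "real \<Rightarrow> real" where
  "coth x = cosh x / sinh x"

definition csch :: "real \<Rightarrow> real" where
  "csch x = 1 / sinh x"

definition diag :: "real ^ 'n \<Rightarrow> real ^ 'n ^ 'n" where
  "diag d = (\<chi> i j. if i = j then d $ i else 0)"

text \<open>Scalar function applied to a diagonal matrix. Off-diagonal entries of the
  argument are ignored, so this is meaningful on diagonal matrices only.\<close>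

definition diag_fun :: "(real \<Rightarrow> real) \<Rightarrow> real ^ 'n ^ 'n \<Rightarrow> real ^ 'n ^ 'n" where
  "diag_fun f A = diag (\<chi> i. f (A $ i $ i))"

lemma diag_fun_diag: "diag_fun f (diag d) = diag (\<chi> i. f (d $ i))"
  by (simp add: diag_fun_def diag_def)

text \<open>Vectors and square matrices of size \<open>2n\<close> are indexed by the sum type \<open>'n + 'n\<close>.\<close>

definition stack :: "real ^ 'n \<Rightarrow> real ^ 'm \<Rightarrow> real ^ ('n + 'm)" where
  "stack y z = (\<chi> k. case k of Inl i \<Rightarrow> y $ i | Inr j \<Rightarrow> z $ j)"

definition block_matrix ::
  "real ^ 'n ^ 'n \<Rightarrow> real ^ 'm ^ 'n \<Rightarrow> real ^ 'n ^ 'm \<Rightarrow> real ^ 'm ^ 'm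
    \<Rightarrow> real ^ ('n + 'm) ^ ('n + 'm)" where
  "block_matrix A B C E =
    (\<chi> k. case k of Inl i \<Rightarrow> stack (A $ i) (B $ i) | Inr j \<Rightarrow> stack (C $ j) (E $ j))"

definition M_matrix :: "real ^ 'n \<Rightarrow> real \<Rightarrow> real \<Rightarrow> real ^ ('n + 'n) ^ ('n + 'n)" where
  "M_matrix d t t0 =
    (let R = diag_fun sqrt (diag d);
         P = R ** diag_fun coth ((2 * (t - t0)) *\<^sub>R R);
         Q = - (R ** diag_fun csch ((2 * (t - t0)) *\<^sub>R R))
     in block_matrix P Q Q P)"

definition kappa_pp ::
  "real ^ 'n \<Rightarrow> real \<Rightarrow> real ^ 'n \<Rightarrow> real \<Rightarrow> real ^ 'n \<Rightarrow> real" where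
  "kappa_pp d t0 y t z =
    det (M_matrix d t t0) powr (1 / 4) /
      ((2 * pi) powr (real CARD('n) / 2) *
        sqrt (det (diag_fun sinh ((2 * (t - t0)) *\<^sub>R diag_fun sqrt (diag d))))) *
    exp (- (1 / 2) * (stack y z \<bullet> (M_matrix d t t0 *v stack y z)))"

definition kappa_0 ::
  "real \<Rightarrow> real ^ 'n \<Rightarrow> real \<Rightarrow> real ^ 'n \<Rightarrow> real" where
  "kappa_0 t0 y t z =
    (4 * pi * (t - t0)) powr (- real CARD('n) / 2) *
    exp (- (norm (y - z))\<^sup>2 / (4 * (t - t0)))"

end

theory Submission
  imports Defs "HOL-Real_Asymp.Real_Asymp"
begin

text \<open>
  All blocks of \<open>M_matrix d t t0\<close> are diagonal, so the kernel factorises over the coordinates and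
  the multivariate limit reduces to limits of one real variable.

  Put \<open>c = 2 (t - t0)\<close> and \<open>r = sqrt (d $ i)\<close>. The quadratic form is a sum over the coordinates
  (lemma \<open>quadratic_form_M_matrix\<close>), with coefficients \<open>r coth (c r)\<close> and \<open>r csch (c r)\<close>. The
  determinant of the block matrix is less immediate: passing to the sum and the difference of the
  two halves of a vector makes it block diagonal (lemma \<open>det_block_matrix_symmetric\<close>), and
  \<open>coth\<^sup>2 - csch\<^sup>2 = 1\<close> then gives \<open>det M = d\<^sub>1 \<cdots> d\<^sub>n\<close> (lemma \<open>det_M_matrix\<close>). The fourth root of
  this determinant vanishes in the limit, and so does the square root of the determinant of
  \<open>sinh (c \<surd>D)\<close>, but their quotient is the product of the \<open>sqrt (r / sinh (c r))\<close>
  (lemma \<open>kappa_pp_eq_prod_exp\<close>).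

  Since \<open>sinh x\<close> behaves like \<open>x\<close> near 0, each of \<open>r / sinh (c r)\<close>, \<open>r coth (c r)\<close> and
  \<open>r csch (c r)\<close> tends to \<open>1 / c\<close> as \<open>r\<close> decreases to 0. The two coefficients of the quadratic form
  thus have the same limit, which completes the square to \<open>|y - z|\<^sup>2 / c\<close>, and the prefactor becomes
  \<open>(2 \<pi> c)\<close> to the power \<open>- n / 2\<close>. This is \<open>kappa_0\<close>.
\<close>

section \<open>Matrices on a doubled index set\<close>

lemma sum_UNIV_sum_type:
  fixes f :: "'n::finite + 'm::finite \<Rightarrow> 'a::comm_monoid_add"
  shows "(\<Sum>k\<in>UNIV. f k) = (\<Sum>i\<in>UNIV. f (Inl i)) + (\<Sum>j\<in>UNIV. f (Inr j))"
  unfolding UNIV_Plus_UNIV [symmetric] by (subst sum.Plus) simp_all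

lemma prod_UNIV_sum_type:
  fixes f :: "'n::finite + 'm::finite \<Rightarrow> 'a::comm_monoid_mult"
  shows "(\<Prod>k\<in>UNIV. f k) = (\<Prod>i\<in>UNIV. f (Inl i)) * (\<Prod>j\<in>UNIV. f (Inr j))"
  unfolding UNIV_Plus_UNIV [symmetric] by (subst prod.Plus) simp_all

lemma stack_nth [simp]: "stack y z $ Inl i = y $ i" "stack y z $ Inr j = z $ j"
  by (simp_all add: stack_def)

lemma block_matrix_nth [simp]:
  "block_matrix A B C E $ Inl i = stack (A $ i) (B $ i)"
  "block_matrix A B C E $ Inr j = stack (C $ j) (E $ j)"
  by (simp_all add: block_matrix_def)

lemma inner_stack: "stack y z \<bullet> stack u v = y \<bullet> u + z \<bullet> v"
  by (simp add: inner_vec_def sum_UNIV_sum_type)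

lemma sum_type_vec_eqI:
  fixes u v :: "'a ^ ('n::finite + 'm::finite)"
  assumes "\<And>i. u $ Inl i = v $ Inl i" "\<And>j. u $ Inr j = v $ Inr j"
  shows "u = v"
  unfolding vec_eq_iff using assms by (metis sum.exhaust)

lemma block_matrix_vector_mult:
  "block_matrix A B C E *v stack y z = stack (A *v y + B *v z) (C *v y + E *v z)"
  by (rule sum_type_vec_eqI) (simp_all add: matrix_vector_mult_def sum_UNIV_sum_type)

lemma block_matrix_mult:
  "block_matrix A B C E ** block_matrix A' B' C' E' =
    block_matrix (A ** A' + B ** C') (A ** B' + B ** E') (C ** A' + E ** C') (C ** B' + E ** E')"
  by (intro sum_type_vec_eqI) (simp_all add: matrix_matrix_mult_def sum_UNIV_sum_type)

lemma det_diag: "det (diag d) = (\<Prod>i\<in>UNIV. d $ i)"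
  by (subst det_diagonal) (simp_all add: diag_def)

lemma det_block_diagonal_diag:
  "det (block_matrix (diag a) 0 0 (diag b)) = (\<Prod>i\<in>UNIV. a $ i * b $ i)"
proof -
  have "block_matrix (diag a) 0 0 (diag b) $ k $ l = 0" if "k \<noteq> l" for k l
    using that by (cases k; cases l) (auto simp: diag_def)
  then show ?thesis
    by (subst det_diagonal) (simp_all add: prod_UNIV_sum_type prod.distrib diag_def)
qed

lemma matrix_minus_mult_left: "(- A) ** B = - (A ** B)"
  and matrix_minus_mult_right: "A ** (- B) = - (A ** B)"
  for A :: "real ^ 'n ^ 'm" and B :: "real ^ 'p ^ 'n"
  by (simp_all add: vec_eq_iff matrix_matrix_mult_def sum_negf)

text \<open>A vector is split into the sum and the difference of its two halves: this change of
  coordinates, the matrix \<open>H\<close> below, turns \<open>block_matrix P Q Q P\<close> into a block diagonal matrix.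
  Its square is twice the identity, so \<open>det H\<close> can be cancelled.\<close>
lemma det_block_matrix_symmetric:
  fixes P Q :: "real ^ 'n ^ 'n"
  shows "det (block_matrix P Q Q P) = det (block_matrix (P + Q) 0 0 (P - Q))"
proof -
  define H :: "real ^ ('n + 'n) ^ ('n + 'n)"
    where "H = block_matrix (mat 1) (mat 1) (mat 1) (- mat 1)"
  have "mat 1 + mat 1 = (diag (\<chi> i. 2) :: real ^ 'n ^ 'n)"
    by (simp add: vec_eq_iff mat_def diag_def)
  then have "H ** H = block_matrix (diag (\<chi> i. 2)) 0 0 (diag (\<chi> i. 2))"
    by (simp add: H_def block_matrix_mult matrix_minus_mult_left matrix_minus_mult_right)
  then have "det H * det H \<noteq> 0"
    by (simp add: det_mul [symmetric] det_block_diagonal_diag)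
  moreover have "H ** block_matrix P Q Q P = block_matrix (P + Q) 0 0 (P - Q) ** H"
    by (simp add: H_def block_matrix_mult matrix_minus_mult_left matrix_minus_mult_right
        add.commute)
  then have "det H * det (block_matrix P Q Q P) = det (block_matrix (P + Q) 0 0 (P - Q)) * det H"
    by (metis det_mul)
  ultimately show ?thesis by simp
qed

section \<open>The kernel in coordinates\<close>

lemma diag_add: "diag a + diag b = diag (a + b)"
  and diag_diff: "diag a - diag b = diag (a - b)"
  and diag_uminus: "- diag a = diag (\<chi> i. - (a $ i))"
  and diag_scaleR: "c *\<^sub>R diag a = diag (c *\<^sub>R a)"
  by (simp_all add: diag_def vec_eq_iff)

lemma diag_mult: "diag a ** diag b = diag (\<chi> i. a $ i * b $ i)"
  by (simp add: diag_def matrix_matrix_mult_def vec_eq_iff if_distrib [of "\<lambda>x. x * _"]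
      if_distrib [of "\<lambda>x. _ * x"] cong: if_cong)

lemma diag_mult_vector: "diag a *v v = (\<chi> i. a $ i * v $ i)"
  by (simp add: diag_def matrix_vector_mult_def vec_eq_iff if_distrib [of "\<lambda>x. x * _"]
      cong: if_cong)

lemma M_matrix_eq_block_diag:
  "M_matrix d t t0 =
    (let P = diag (\<chi> i. sqrt (d $ i) * coth (2 * (t - t0) * sqrt (d $ i)));
         Q = diag (\<chi> i. - (sqrt (d $ i) * csch (2 * (t - t0) * sqrt (d $ i))))
     in block_matrix P Q Q P)"
  by (simp add: M_matrix_def Let_def diag_fun_diag diag_scaleR diag_mult diag_uminus)

lemma coth_square_minus_csch_square: "x \<noteq> 0 \<Longrightarrow> (coth x)\<^sup>2 - (csch x)\<^sup>2 = 1"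
  by (simp add: coth_def csch_def power_divide diff_divide_distrib [symmetric] cosh_square_eq)

text \<open>On each coordinate the sum and difference blocks contribute
  \<open>r\<^sup>2 (coth\<^sup>2 - csch\<^sup>2) = r\<^sup>2\<close> with \<open>r = sqrt (d $ i)\<close>, so the time dependence cancels.\<close>
lemma det_M_matrix:
  assumes "t0 < t" and "\<forall>i. 0 < d $ i"
  shows "det (M_matrix d t t0) = (\<Prod>i\<in>UNIV. d $ i)"
proof -
  have "(r * C + - (r * S)) * (r * C - - (r * S)) = r\<^sup>2 * (C\<^sup>2 - S\<^sup>2)" for r C S :: real
    by (simp add: algebra_simps power2_eq_square)
  moreover have "(coth (2 * (t - t0) * sqrt (d $ i)))\<^sup>2 - (csch (2 * (t - t0) * sqrt (d $ i)))\<^sup>2 = 1"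
      and "(sqrt (d $ i))\<^sup>2 = d $ i" for i
    using assms by (auto intro!: coth_square_minus_csch_square
        simp: less_imp_neq [symmetric] less_imp_le)
  ultimately show ?thesis
    by (simp only: M_matrix_eq_block_diag Let_def det_block_matrix_symmetric diag_add diag_diff
        det_block_diagonal_diag vector_add_component vector_minus_component vec_lambda_beta
        mult_1_right)
qed

lemma quadratic_form_M_matrix:
  "stack y z \<bullet> (M_matrix d t t0 *v stack y z) =
    (\<Sum>i\<in>UNIV. sqrt (d $ i) * coth (2 * (t - t0) * sqrt (d $ i)) * ((y $ i)\<^sup>2 + (z $ i)\<^sup>2)
       - 2 * (sqrt (d $ i) * csch (2 * (t - t0) * sqrt (d $ i))) * (y $ i * z $ i))"
  unfolding M_matrix_eq_block_diag Let_def block_matrix_vector_mult inner_stack diag_mult_vector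
  unfolding inner_vec_def sum.distrib [symmetric]
  by (rule sum.cong) (simp_all add: algebra_simps power2_eq_square)

lemma sqrt_prod: "sqrt (\<Prod>i\<in>A. f i) = (\<Prod>i\<in>A. sqrt (f i))"
  by (induction A rule: infinite_finite_induct) (simp_all add: real_sqrt_mult)

text \<open>Both determinants are products over the coordinates; pairing the factors of
  \<open>sqrt (sqrt (det M))\<close> with those of the normalising root leaves the quotients
  \<open>r / sinh (2 (t - t0) r)\<close>, which stay bounded as \<open>r\<close> tends to 0.\<close>
lemma kappa_pp_eq_prod_exp:
  fixes d y z :: "real ^ 'n"
  assumes "t0 < t" and d: "\<forall>i. 0 < d $ i"
  shows "kappa_pp d t0 y t z =
    (\<Prod>i\<in>UNIV. sqrt (sqrt (d $ i) / sinh (2 * (t - t0) * sqrt (d $ i)))) /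
      (2 * pi) powr (real CARD('n) / 2) *
    exp (- (1 / 2) * (\<Sum>i\<in>UNIV.
       sqrt (d $ i) * coth (2 * (t - t0) * sqrt (d $ i)) * ((y $ i)\<^sup>2 + (z $ i)\<^sup>2)
       - 2 * (sqrt (d $ i) * csch (2 * (t - t0) * sqrt (d $ i))) * (y $ i * z $ i)))"
proof -
  have "0 \<le> (\<Prod>i\<in>UNIV. d $ i)"
    using d by (simp add: prod_nonneg less_imp_le)
  moreover have "x powr (1 / 4) = sqrt (sqrt x)" if "0 \<le> x" for x
    using that by (simp add: powr_half_sqrt [symmetric] powr_powr)
  ultimately have "det (M_matrix d t t0) powr (1 / 4) = (\<Prod>i\<in>UNIV. sqrt (sqrt (d $ i)))"
    using assms by (simp add: det_M_matrix sqrt_prod)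
  moreover have "sqrt (det (diag_fun sinh ((2 * (t - t0)) *\<^sub>R diag_fun sqrt (diag d)))) =
      (\<Prod>i\<in>UNIV. sqrt (sinh (2 * (t - t0) * sqrt (d $ i))))"
    by (simp add: diag_fun_diag diag_scaleR det_diag sqrt_prod)
  ultimately show ?thesis
    by (simp add: kappa_pp_def quadratic_form_M_matrix real_sqrt_divide prod_dividef mult.commute)
qed

section \<open>The limit of vanishing frequencies\<close>

lemma tendsto_div_sinh: "0 < c \<Longrightarrow> ((\<lambda>r. r / sinh (c * r)) \<longlongrightarrow> 1 / c) (at_right 0)"
  for c :: real
  unfolding inverse_eq_divide [symmetric] by real_asymp

lemma tendsto_mult_coth: "0 < c \<Longrightarrow> ((\<lambda>r. r * coth (c * r)) \<longlongrightarrow> 1 / c) (at_right 0)"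
  unfolding coth_def inverse_eq_divide [symmetric] by real_asymp

lemma tendsto_mult_csch: "0 < c \<Longrightarrow> ((\<lambda>r. r * csch (c * r)) \<longlongrightarrow> 1 / c) (at_right 0)"
  unfolding csch_def inverse_eq_divide [symmetric] by real_asymp

lemma filterlim_sqrt_coordinate_at_right_0:
  "filterlim (\<lambda>d :: real ^ 'n. sqrt (d $ i)) (at_right 0) (at 0 within {d. \<forall>i. 0 < d $ i})"
proof (rule filterlim_at_withinI)
  have "((\<lambda>d :: real ^ 'n. sqrt (d $ i)) \<longlongrightarrow> sqrt (0 $ i)) (at 0 within {d. \<forall>i. 0 < d $ i})"
    by (intro tendsto_intros)
  then show "((\<lambda>d :: real ^ 'n. sqrt (d $ i)) \<longlongrightarrow> 0) (at 0 within {d. \<forall>i. 0 < d $ i})"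
    by simp
  show "\<forall>\<^sub>F d :: real ^ 'n in at 0 within {d. \<forall>i. 0 < d $ i}. sqrt (d $ i) \<in> {0<..} - {0}"
    by (auto simp: eventually_at_filter less_imp_neq [symmetric] intro!: always_eventually)
qed

text \<open>The form matches \<open>kappa_pp_eq_prod_exp\<close> with each of the three coefficient functions replaced
  by its limit \<open>1 / (2 (t - t0))\<close>; the kernels can then be compared factor by factor.\<close>
lemma kappa_0_eq_prod_exp:
  fixes y z :: "real ^ 'n"
  assumes "t0 < t"
  shows "kappa_0 t0 y t z =
    (\<Prod>i\<in>(UNIV :: 'n set). sqrt (1 / (2 * (t - t0)))) / (2 * pi) powr (real CARD('n) / 2) *
    exp (- (1 / 2) * (\<Sum>i\<in>UNIV. 1 / (2 * (t - t0)) * ((y $ i)\<^sup>2 + (z $ i)\<^sup>2)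
       - 2 * (1 / (2 * (t - t0))) * (y $ i * z $ i)))"
proof -
  define c where "c = 2 * (t - t0)"
  have c: "0 < c" using assms by (simp add: c_def)
  have "sqrt (1 / c) ^ CARD('n) = c powr (- real CARD('n) / 2)"
    using c by (simp add: powr_realpow [symmetric] powr_half_sqrt [symmetric] powr_powr
        powr_minus_divide powr_divide real_sqrt_divide)
  then have prefactor: "(4 * pi * (t - t0)) powr (- real CARD('n) / 2) =
      sqrt (1 / c) ^ CARD('n) / (2 * pi) powr (real CARD('n) / 2)"
    using c by (simp add: c_def powr_mult [symmetric] powr_minus_divide mult_ac)
  have "(norm (y - z))\<^sup>2 = (\<Sum>i\<in>UNIV. (y $ i - z $ i)\<^sup>2)"
    unfolding power2_norm_eq_inner inner_vec_def by (simp add: power2_eq_square)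
  moreover have "1 / c * (a\<^sup>2 + b\<^sup>2) - 2 * (1 / c) * (a * b) = (a - b)\<^sup>2 / c" for a b
    by (simp add: power2_diff diff_divide_distrib add_divide_distrib)
  moreover have "4 * (t - t0) = 2 * c"
    by (simp add: c_def)
  ultimately have "- (norm (y - z))\<^sup>2 / (4 * (t - t0)) = - (1 / 2) *
      (\<Sum>i\<in>UNIV. 1 / c * ((y $ i)\<^sup>2 + (z $ i)\<^sup>2) - 2 * (1 / c) * (y $ i * z $ i))"
    by (simp add: sum_divide_distrib [symmetric])
  with prefactor show ?thesis
    unfolding kappa_0_def c_def [symmetric] by simp
qed

theorem theorem4p8:
  fixes t0 t :: real and y z :: "real ^ 'n"
  assumes "0 \<le> t0" and "t0 < t"
  shows "((\<lambda>d :: real ^ 'n. kappa_pp d t0 y t z) \<longlongrightarrow> kappa_0 t0 y t z)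
           (at 0 within {d. \<forall>i. 0 < d $ i})"
proof -
  define F where "F = at (0 :: real ^ 'n) within {d. \<forall>i. 0 < d $ i}"
  define c where "c = 2 * (t - t0)"
  have c: "0 < c" using assms by (simp add: c_def)
  have r: "filterlim (\<lambda>d :: real ^ 'n. sqrt (d $ i)) (at_right 0) F" for i
    unfolding F_def by (rule filterlim_sqrt_coordinate_at_right_0)
  note lims = filterlim_compose [OF tendsto_div_sinh [OF c] r]
    filterlim_compose [OF tendsto_mult_coth [OF c] r]
    filterlim_compose [OF tendsto_mult_csch [OF c] r]
  have "((\<lambda>d :: real ^ 'n.
      (\<Prod>i\<in>UNIV. sqrt (sqrt (d $ i) / sinh (c * sqrt (d $ i)))) /
        (2 * pi) powr (real CARD('n) / 2) *
      exp (- (1 / 2) * (\<Sum>i\<in>UNIV.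
         sqrt (d $ i) * coth (c * sqrt (d $ i)) * ((y $ i)\<^sup>2 + (z $ i)\<^sup>2)
         - 2 * (sqrt (d $ i) * csch (c * sqrt (d $ i))) * (y $ i * z $ i))))
      \<longlongrightarrow> kappa_0 t0 y t z) F"
    unfolding kappa_0_eq_prod_exp [OF \<open>t0 < t\<close>] c_def [symmetric]
    by (intro tendsto_mult tendsto_divide tendsto_prod tendsto_sum tendsto_diff tendsto_exp
        tendsto_real_sqrt tendsto_const lims) auto
  \<comment> \<open>The closed form of the kernel is available for positive \<open>d\<close>, which is where the filter lives.\<close>
  moreover have "\<forall>\<^sub>F d in F. (\<forall>i. 0 < d $ i)"
    unfolding F_def by (simp add: eventually_at_filter)
  ultimately show ?thesis
    unfolding F_def [symmetric] c_def
    by (elim Lim_transform_eventually eventually_mono)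
      (simp add: kappa_pp_eq_prod_exp [OF \<open>t0 < t\<close>])
qed

end
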